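(* For any positive integers $r,n$ with $r\le n$, there exists an induced subgraph $G_r$ of $L_r(n)$ that contains no cycle of length $6$ and satisfies \[ e(G_r) > \frac{c}{2}\cdot e(L_r(n)), \qquad \text{where } c=\prod_{k=1}^\infty\left(1-\frac{1}{2^k}\right). \]
   Context: Identify the vertices of the hypercube $Q_n$ (vertex set $\{0,1\}^n$, edges between vertices differing in exactly one coordinate) with subsets of $[n]=\{1,\dots,n\}$. For $r\le n$, the $r$-th layer $L_r(n)$ is the subgraph of $Q_n$ consisting of the edges between $\binom{[n]}{r-1}$ and $\binom{[n]}{r}$ (together with these vertices), where $\binom{[n]}{r}$ is the family of $r$-element subsets of $[n]$. $e(\cdot)$ denotes the number of edges. *)

theory Defs
  imports "HOL-Analysis.Infinite_Products"
begin

record 'a ugraph =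
  verts :: "'a set"
  edges :: "'a set set"

definition induced_subgraph :: "'a ugraph \<Rightarrow> 'a ugraph \<Rightarrow> bool" where
  "induced_subgraph H G \<longleftrightarrow>
     verts H \<subseteq> verts G \<and> edges H = {e \<in> edges G. e \<subseteq> verts H}"

(* Cycles are subgraphs, not necessarily induced ones: chords are permitted. *)
definition contains_cycle :: "'a ugraph \<Rightarrow> nat \<Rightarrow> bool" where
  "contains_cycle G k \<longleftrightarrow> 3 \<le> k \<and>
     (\<exists>vs. length vs = k \<and> distinct vs \<and> set vs \<subseteq> verts G \<and>
        (\<forall>i<k. {vs ! i, vs ! ((i + 1) mod k)} \<in> edges G))"

definition num_edges :: "'a ugraph \<Rightarrow> nat" where
  "num_edges G = card (edges G)"

(* A 0-1 vector is identified with its support, so the coordinates in which two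
   vertices differ form the symmetric difference of the two sets. *)
definition hypercube :: "nat \<Rightarrow> nat set ugraph" where
  "hypercube n =
     \<lparr>verts = Pow {1..n},
      edges = {{A, B} | A B. A \<subseteq> {1..n} \<and> B \<subseteq> {1..n} \<and> card ((A - B) \<union> (B - A)) = 1}\<rparr>"

definition subsets_of_size :: "nat \<Rightarrow> nat \<Rightarrow> nat set set" where
  "subsets_of_size n r = {A. A \<subseteq> {1..n} \<and> card A = r}"

(* Meaningful for 1 \<le> r only, because of the truncated subtraction r - 1. *)
definition layer :: "nat \<Rightarrow> nat \<Rightarrow> nat set ugraph" where
  "layer r n =
     \<lparr>verts = subsets_of_size n (r - 1) \<union> subsets_of_size n r,
      edges = {e \<in> edges (hypercube n).
                 \<exists>A \<in> subsets_of_size n (r - 1). \<exists>B \<in> subsets_of_size n r. e = {A, B}}\<rparr>"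

end

theory Submission
  imports Defs
begin

text \<open>
  Choose vectors \<open>v 0, \<dots>, v n\<close> of \<open>F\<^sub>2\<^sup>r\<close> independently and uniformly at random. Keep an \<open>r\<close>-set if
  its vectors form a basis, and an \<open>(r - 1)\<close>-set if its vectors together with \<open>v 0\<close> form a basis.
  Given that \<open>A \<union> {b}\<close> is kept, \<open>v 0\<close> avoids the hyperplane spanned by \<open>A\<close> with probability \<open>1/2\<close>, so
  an edge survives with probability \<open>1/2 \<cdot> (\<Prod>k=1..r. 1 - 2\<^sup>-\<^sup>k) > c/2\<close>. A six-cycle in a layer consists
  of the sets \<open>C \<union> {x}\<close> and \<open>C \<union> {x, y}\<close> with \<open>x, y\<close> from a triple \<open>a, b, c\<close>; if all six were kept, then
  \<open>v a, v b, v c, v 0\<close> would be four distinct nonzero vectors in the two-dimensional quotient by the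
  span of \<open>C\<close>, which has only three.
\<close>

unbundle bit_operations_syntax

section \<open>Linear algebra over the field with two elements\<close>

text \<open>The vectors of \<open>F\<^sub>2\<^sup>r\<close> are the natural numbers below \<open>2\<^sup>r\<close>, added by \<open>XOR\<close> of binary digits.\<close>

inductive_set xor_span :: "(nat \<Rightarrow> nat) \<Rightarrow> nat set \<Rightarrow> nat set" for v A where
  zero: "0 \<in> xor_span v A"
| step: "x \<in> xor_span v A \<Longrightarrow> a \<in> A \<Longrightarrow> x XOR v a \<in> xor_span v A"

text \<open>For finite \<open>A\<close> this is linear independence of the indexed family
  \<open>v a\<close>, so equal vectors at different indices count as dependent. The form by
  cardinality suits the counting below.\<close>

definition xor_indep :: "(nat \<Rightarrow> nat) \<Rightarrow> nat set \<Rightarrow> bool" where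
  "xor_indep v A \<longleftrightarrow> card (xor_span v A) = 2 ^ card A"

lemma xor_self_right: "(x XOR y) XOR y = (x::nat)"
  by (simp add: xor.assoc)

lemma xor_span_empty: "xor_span v {} = {0}"
proof -
  have "x = 0" if "x \<in> xor_span v {}" for x
    using that by induction auto
  then show ?thesis by (auto intro: xor_span.zero)
qed

lemma xor_span_mono: "A \<subseteq> B \<Longrightarrow> xor_span v A \<subseteq> xor_span v B"
proof
  fix x assume "A \<subseteq> B" "x \<in> xor_span v A"
  from this(2,1) show "x \<in> xor_span v B"
    by induction (auto intro: xor_span.intros)
qed

lemma xor_span_xor: "y \<in> xor_span v A \<Longrightarrow> x \<in> xor_span v A \<Longrightarrow> x XOR y \<in> xor_span v A"
  by (induction rule: xor_span.induct) (auto simp flip: xor.assoc intro: xor_span.intros)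

lemma xor_span_cong:
  assumes "\<And>a. a \<in> A \<Longrightarrow> v a = u a"
  shows "xor_span v A = xor_span u A"
proof -
  have *: "x \<in> xor_span u A" if "x \<in> xor_span v A" "\<And>a. a \<in> A \<Longrightarrow> v a = u a" for x v u
    using that by induction (auto intro: xor_span.intros)
  show ?thesis using *[of _ v u] *[of _ u v] assms by auto
qed

lemma xor_indep_cong:
  assumes "\<And>a. a \<in> A \<Longrightarrow> v a = u a"
  shows "xor_indep v A = xor_indep u A"
  using xor_span_cong[OF assms] by (simp add: xor_indep_def)

lemma xor_less_power2: "(x::nat) < 2 ^ r \<Longrightarrow> y < 2 ^ r \<Longrightarrow> x XOR y < 2 ^ r"
  by (metis take_bit_nat_eq_self_iff take_bit_xor)

lemma xor_span_less_power2:
  assumes "\<And>a. a \<in> A \<Longrightarrow> v a < 2 ^ r"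
  shows "xor_span v A \<subseteq> {..<2 ^ r}"
proof
  fix x assume "x \<in> xor_span v A"
  then show "x \<in> {..<2 ^ r}"
    by induction (use assms xor_less_power2 in auto)
qed

text \<open>The coefficient of \<open>v a\<close> is 0 or 1, so the larger span is a union of two
  cosets of the smaller one.\<close>

lemma xor_span_insert_iff:
  "x \<in> xor_span v (insert a A) \<longleftrightarrow> x \<in> xor_span v A \<or> x XOR v a \<in> xor_span v A"
proof
  assume "x \<in> xor_span v (insert a A)"
  then show "x \<in> xor_span v A \<or> x XOR v a \<in> xor_span v A"
  proof induction
    case zero
    then show ?case by (auto intro: xor_span.zero)
  next
    case (step x b)
    \<comment> \<open>Adding \<open>v a\<close> exchanges the two cosets; adding \<open>v b\<close>
      with \<open>b\<close> in \<open>A\<close> preserves each of them.\<close>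
    have "(x XOR v b) XOR v a = (x XOR v a) XOR v b"
      by (simp add: ac_simps)
    then show ?case
      using step xor_span.step[of x v A b] xor_span.step[of "x XOR v a" v A b]
      by (auto simp: xor_self_right)
  qed
next
  have sub: "xor_span v A \<subseteq> xor_span v (insert a A)"
    by (rule xor_span_mono) auto
  assume "x \<in> xor_span v A \<or> x XOR v a \<in> xor_span v A"
  then show "x \<in> xor_span v (insert a A)"
    using sub xor_span.step[of "x XOR v a" v "insert a A" a]
    by (auto simp: xor_self_right)
qed

lemma xor_span_insert:
  "xor_span v (insert a A) = xor_span v A \<union> (\<lambda>x. x XOR v a) ` xor_span v A"
proof -
  have "x \<in> (\<lambda>x. x XOR v a) ` xor_span v A" if "x XOR v a \<in> xor_span v A" for x
    using that by (intro image_eqI[of _ _ "x XOR v a"]) (simp_all add: xor_self_right)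
  then show ?thesis by (auto simp: xor_span_insert_iff xor_self_right)
qed

lemma finite_xor_span: "finite A \<Longrightarrow> finite (xor_span v A)"
  by (induction rule: finite_induct) (auto simp: xor_span_empty xor_span_insert)

text \<open>The two cosets are equal or disjoint: a common element would make \<open>v a\<close> a
  sum of two elements of the span.\<close>

lemma card_xor_span_insert:
  assumes "finite A"
  shows "card (xor_span v (insert a A)) =
    (if v a \<in> xor_span v A then card (xor_span v A) else 2 * card (xor_span v A))"
proof (cases "v a \<in> xor_span v A")
  case True
  then have "xor_span v (insert a A) = xor_span v A"
    by (auto simp: xor_span_insert intro: xor_span_xor)
  then show ?thesis using True by simp
next
  case False
  have "xor_span v A \<inter> (\<lambda>x. x XOR v a) ` xor_span v A = {}"
  proof safe
    fix x assume "x XOR v a \<in> xor_span v A" "x \<in> xor_span v A"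
    then have "x XOR (x XOR v a) \<in> xor_span v A" by (rule xor_span_xor)
    then show "x XOR v a \<in> {}" using False by (simp flip: xor.assoc)
  qed
  moreover have "inj_on (\<lambda>x. x XOR v a) (xor_span v A)"
    by (rule inj_on_inverseI[where g = "\<lambda>x. x XOR v a"]) (rule xor_self_right)
  ultimately show ?thesis
    using False finite_xor_span[OF assms]
    by (simp add: xor_span_insert card_Un_disjoint card_image)
qed

lemma card_xor_span_le: "finite A \<Longrightarrow> card (xor_span v A) \<le> 2 ^ card A"
  by (induction rule: finite_induct) (auto simp: xor_span_empty card_xor_span_insert)

text \<open>If \<open>v a\<close> is outside the span, both sides of the defining equation double.
  If it is inside, the span keeps at most \<open>2 ^ card A\<close> elements, which is too
  few.\<close>

lemma xor_indep_insert_iff: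
  assumes "finite A" "a \<notin> A"
  shows "xor_indep v (insert a A) \<longleftrightarrow> xor_indep v A \<and> v a \<notin> xor_span v A"
  using card_xor_span_le[OF assms(1), of v] assms
  by (auto simp: xor_indep_def card_xor_span_insert)

text \<open>The span has \<open>2 ^ r\<close> elements and lies in a set of that size.\<close>

lemma xor_indep_spans:
  assumes "xor_indep v A" "card A = r" "finite A" "\<And>a. a \<in> A \<Longrightarrow> v a < 2 ^ r"
  shows "xor_span v A = {..<2 ^ r}"
  using assms xor_span_less_power2[of A v r]
  by (intro card_subset_eq) (auto simp: xor_indep_def)

text \<open>Modulo the span of \<open>C\<close>, both \<open>v c\<close> and \<open>v w\<close> must
  be the third nonzero vector \<open>v a XOR v b\<close>. Hence they are congruent, which
  contradicts \<open>wc\<close>.\<close>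

lemma no_four_lines:
  assumes fin: "finite C" and card: "card C + 2 = r"
    and notin: "a \<notin> C" "b \<notin> C" "c \<notin> C" "w \<notin> C" "a \<noteq> b" "b \<noteq> c" "a \<noteq> c" "w \<noteq> a" "w \<noteq> b" "w \<noteq> c"
    and lt: "\<And>x. x \<in> insert w (insert a (insert b (insert c C))) \<Longrightarrow> v x < 2 ^ r"
    and ab: "xor_indep v (insert a (insert b C))"
    and bc: "xor_indep v (insert b (insert c C))"
    and ca: "xor_indep v (insert c (insert a C))"
    and wa: "xor_indep v (insert w (insert a C))"
    and wb: "xor_indep v (insert w (insert b C))"
    and wc: "xor_indep v (insert w (insert c C))"
  shows False
proof -
  let ?H = "xor_span v C"
  have full: "xor_span v (insert a (insert b C)) = {..<2 ^ r}"
    using ab fin card notin lt by (intro xor_indep_spans) auto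
  \<comment> \<open>The full space consists of four cosets of \<open>?H\<close>; the two
    non-memberships exclude all but that of \<open>v a XOR v b\<close>. The index \<open>x'\<close>
    only supplies the bound on \<open>x\<close>.\<close>
  have third: "x XOR v a XOR v b \<in> ?H"
    if "v x' = x" "x' \<in> {c, w}" "x \<notin> xor_span v (insert a C)" "x \<notin> xor_span v (insert b C)" for x x'
  proof -
    have "x \<in> xor_span v (insert a (insert b C))"
      unfolding full using that lt by auto
    then show ?thesis
      using that(3,4) by (auto simp: xor_span_insert_iff xor.assoc)
  qed
  have "v c \<notin> xor_span v (insert a C)" "v c \<notin> xor_span v (insert b C)"
    using ca bc fin notin xor_indep_insert_iff[of "insert b C" c v]
    by (auto simp: xor_indep_insert_iff insert_commute[of b c])
  then have c: "v c XOR v a XOR v b \<in> ?H" using third by auto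
  have "v w \<notin> xor_span v (insert a C)" "v w \<notin> xor_span v (insert b C)"
    using wa wb fin notin by (auto simp: xor_indep_insert_iff)
  then have w: "v w XOR v a XOR v b \<in> ?H" using third by auto
  have "(v w XOR v a XOR v b) XOR (v c XOR v a XOR v b) = v w XOR v c"
    by (rule bit_eqI) (auto simp: bit_simps)
  then have "v w XOR v c \<in> ?H" using xor_span_xor[OF c w] by simp
  then have "v w \<in> xor_span v (insert c C)" by (simp add: xor_span_insert_iff)
  then show False using wc fin notin by (simp add: xor_indep_insert_iff)
qed

section \<open>Counting independent families\<close>

text \<open>Swapping \<open>f j\<close> with the extra value \<open>x\<close> is a bijection between the two sides.\<close>

lemma card_coordinate_avoiding:
  fixes H :: "('i \<Rightarrow> 'a) \<Rightarrow> 'a set"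
  assumes fin: "finite I" "finite V" and j: "j \<in> I"
    and P: "\<And>f x. P (f(j := x)) \<longleftrightarrow> P f" and H: "\<And>f x. H (f(j := x)) = H f"
    and sub: "\<And>f. f \<in> I \<rightarrow>\<^sub>E V \<Longrightarrow> P f \<Longrightarrow> H f \<subseteq> V \<and> card (H f) = h"
  shows "card {f \<in> I \<rightarrow>\<^sub>E V. P f \<and> f j \<notin> H f} * card V = card {f \<in> I \<rightarrow>\<^sub>E V. P f} * (card V - h)"
proof -
  define F where "F = I \<rightarrow>\<^sub>E V"
  let ?L = "{f \<in> F. P f \<and> f j \<notin> H f} \<times> V"
  let ?R = "SIGMA f:{f \<in> F. P f}. V - H f"
  let ?t = "\<lambda>(f, x). (f(j := x), f j)"
  have finF: "finite F" using fin by (auto simp: F_def intro: finite_PiE)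
  have upd: "f(j := x) \<in> F" if "f \<in> F" "x \<in> V" for f x
    using that j by (auto simp: F_def PiE_iff extensional_def)
  have mem: "f j \<in> V" if "f \<in> F" for f using that j by (auto simp: F_def)
  \<comment> \<open>\<open>?t\<close> is an involution. As \<open>P\<close> and \<open>H\<close>
    ignore coordinate \<open>j\<close>, the condition on \<open>f j\<close> becomes the same
    condition on the extra value.\<close>
  have "bij_betw ?t ?L ?R"
    by (rule bij_betw_byWitness[where f' = ?t]) (auto simp: P H upd mem)
  then have "card ?L = card ?R" by (rule bij_betw_same_card)
  also have "card ?R = (\<Sum>f\<in>{f \<in> F. P f}. card (V - H f))"
    using finF fin by simp
  also have "\<dots> = (\<Sum>f\<in>{f \<in> F. P f}. card V - h)"
  proof (intro sum.cong refl)
    fix f assume "f \<in> {f \<in> F. P f}"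
    then show "card (V - H f) = card V - h"
      using sub[of f] fin by (auto simp: F_def card_Diff_subset finite_subset)
  qed
  finally show ?thesis by (simp add: F_def card_cartesian_product)
qed

text \<open>A conditional probability: given that \<open>B\<close> is independent,
  \<open>v j\<close> is still uniform and must avoid the \<open>2 ^ card A\<close> vectors spanned
  by \<open>A\<close>. The case \<open>A = B\<close> builds up a basis; a larger \<open>B\<close>
  serves the extra vector \<open>v 0\<close>.\<close>

lemma card_xor_indep_insert:
  assumes "finite I" "j \<in> I" "A \<subseteq> B" "B \<subseteq> I" "j \<notin> B" "card A \<le> r"
    and AB: "\<And>v. xor_indep v B \<Longrightarrow> xor_indep v A"
  shows "real (card {v \<in> I \<rightarrow>\<^sub>E {..<2 ^ r}. xor_indep v B \<and> xor_indep v (insert j A)}) =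
    real (card {v \<in> I \<rightarrow>\<^sub>E {..<2 ^ r}. xor_indep v B}) * (1 - 2 ^ card A / 2 ^ r)"
proof -
  let ?F = "I \<rightarrow>\<^sub>E {..<2 ^ r :: nat}"
  have finA: "finite A" using assms(1,3,4) by (meson finite_subset)
  have "card {v \<in> ?F. xor_indep v B \<and> v j \<notin> xor_span v A} * card {..<2 ^ r :: nat} =
    card {v \<in> ?F. xor_indep v B} * (card {..<2 ^ r :: nat} - 2 ^ card A)"
  proof (rule card_coordinate_avoiding)
    show "xor_indep (v(j := x)) B = xor_indep v B" for v x
      using assms by (intro xor_indep_cong) auto
    show "xor_span (v(j := x)) A = xor_span v A" for v x
      using assms by (intro xor_span_cong) auto
    show "xor_span v A \<subseteq> {..<2 ^ r} \<and> card (xor_span v A) = 2 ^ card A"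
      if "v \<in> ?F" "xor_indep v B" for v
    proof
      have "v a < 2 ^ r" if "a \<in> A" for a
        using PiE_mem[OF \<open>v \<in> ?F\<close>, of a] that assms(3,4) by auto
      then show "xor_span v A \<subseteq> {..<2 ^ r}" by (rule xor_span_less_power2)
      show "card (xor_span v A) = 2 ^ card A"
        using AB[OF that(2)] by (simp add: xor_indep_def)
    qed
  qed (use assms in auto)
  moreover have "{v \<in> ?F. xor_indep v B \<and> v j \<notin> xor_span v A} =
      {v \<in> ?F. xor_indep v B \<and> xor_indep v (insert j A)}"
    using AB xor_indep_insert_iff[OF finA, of j] assms(3,5) by blast
  ultimately have "card {v \<in> ?F. xor_indep v B \<and> xor_indep v (insert j A)} * 2 ^ r =
    card {v \<in> ?F. xor_indep v B} * (2 ^ r - 2 ^ card A)" by simp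
  \<comment> \<open>The bound \<open>k \<le> r\<close> keeps the natural-number subtraction from
    being truncated.\<close>
  moreover have "real x = real y * (1 - 2 ^ k / 2 ^ r)" if "x * 2 ^ r = y * (2 ^ r - 2 ^ k)" "k \<le> r" for x y k
  proof -
    have "(2::nat) ^ k \<le> 2 ^ r" using that(2) by simp
    then have "real x * 2 ^ r = real y * (2 ^ r - 2 ^ k)"
      using arg_cong[OF that(1), of real] by (simp add: of_nat_diff)
    then show ?thesis by (simp add: right_diff_distrib nonzero_eq_divide_eq[symmetric] diff_divide_distrib)
  qed
  ultimately show ?thesis using \<open>card A \<le> r\<close> by blast
qed

text \<open>Vectors are added one at a time: factor \<open>i\<close> is the probability of avoiding
  the span of the \<open>i\<close> earlier ones.\<close>

lemma card_xor_indep: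
  assumes "finite I" "A \<subseteq> I" "card A \<le> r"
  shows "real (card {v \<in> I \<rightarrow>\<^sub>E {..<2 ^ r}. xor_indep v A}) =
    real (card (I \<rightarrow>\<^sub>E {..<2 ^ r :: nat})) * (\<Prod>i<card A. 1 - 2 ^ i / 2 ^ r)"
proof -
  have "finite A" using assms finite_subset by blast
  then show ?thesis using assms
  proof (induction rule: finite_induct)
    case empty
    then show ?case by (simp add: xor_indep_def xor_span_empty)
  next
    case (insert a A)
    have "{v \<in> I \<rightarrow>\<^sub>E {..<2 ^ r}. xor_indep v (insert a A)} =
        {v \<in> I \<rightarrow>\<^sub>E {..<2 ^ r}. xor_indep v A \<and> xor_indep v (insert a A)}"
      using insert by (auto simp: xor_indep_insert_iff)
    then show ?case
      using card_xor_indep_insert[of I a A A r] insert by simp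
  qed
qed

section \<open>Six-cycles in a layer\<close>

lemma layer_edge_iff:
  assumes "1 \<le> r"
  shows "e \<in> edges (layer r n) \<longleftrightarrow>
    (\<exists>A b. A \<subseteq> {1..n} \<and> card A = r - 1 \<and> b \<in> {1..n} - A \<and> e = {A, insert b A})"
    (is "_ \<longleftrightarrow> ?R")
proof
  assume "e \<in> edges (layer r n)"
  then obtain A B A' B' where AB: "A \<subseteq> {1..n}" "card A = r - 1" "B \<subseteq> {1..n}" "card B = r" "e = {A, B}"
    and e': "e = {A', B'}" "card ((A' - B') \<union> (B' - A')) = 1"
    by (auto simp: layer_def hypercube_def subsets_of_size_def)
  have fin: "finite A" "finite B" using AB finite_subset by blast+
  have "card ((A - B) \<union> (B - A)) = 1"
    using e' AB(5) by (auto simp: doubleton_eq_iff Un_commute)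
  then have "card (A - B) + card (B - A) = 1"
    using fin by (subst (asm) card_Un_disjoint) auto
  moreover have "card A = card (A \<inter> B) + card (A - B)" "card B = card (A \<inter> B) + card (B - A)"
    using fin by (auto simp: card_Diff_subset_Int card_mono Int_commute)
  \<comment> \<open>\<open>B\<close> has one element more than \<open>A\<close>, so the single
    differing element lies in \<open>B\<close>.\<close>
  ultimately have "card (A - B) = 0" "card (B - A) = 1"
    using AB assms by auto
  then obtain b where "A \<subseteq> B" "B - A = {b}"
    using fin by (auto simp: card_1_singleton_iff)
  then have "B = insert b A" "b \<notin> A" "b \<in> B" by auto
  then show ?R using AB by blast
next
  assume ?R
  then obtain A b where A: "A \<subseteq> {1..n}" "card A = r - 1" "b \<in> {1..n}" "b \<notin> A" "e = {A, insert b A}"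
    by blast
  have "finite A" using A finite_subset by blast
  then have "card (insert b A) = r" using A assms by simp
  moreover have "(A - insert b A) \<union> (insert b A - A) = {b}" using A by auto
  ultimately have "card ((A - insert b A) \<union> (insert b A - A)) = 1"
      and "insert b A \<in> subsets_of_size n r" "A \<in> subsets_of_size n (r - 1)"
    using A by (auto simp: subsets_of_size_def)
  then show "e \<in> edges (layer r n)"
    unfolding layer_def hypercube_def A(5) ugraph.simps mem_Collect_eq
    by (intro conjI bexI exI[of _ A] exI[of _ "insert b A"]) (auto simp: subsets_of_size_def)
qed

lemma layer_edge_cases:
  assumes "{x, y} \<in> edges (layer r n)" "1 \<le> r"
  shows "card x = r - 1 \<and> card y = r \<and> x \<subseteq> y \<or> card y = r - 1 \<and> card x = r \<and> y \<subseteq> x"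
proof -
  from assms obtain A b where A: "A \<subseteq> {1..n}" "card A = r - 1" "b \<notin> A" "{x, y} = {A, insert b A}"
    by (auto simp: layer_edge_iff)
  moreover have "finite A" using A finite_subset by blast
  ultimately have "card (insert b A) = r" using assms by simp
  then show ?thesis using A by (auto simp: doubleton_eq_iff)
qed

lemma card_Suc_superset:
  assumes "finite B" "A \<subseteq> B" "card B = Suc (card A)"
  obtains b where "b \<notin> A" "B = insert b A"
proof -
  have "card (B - A) = 1"
    using assms by (simp add: card_Diff_subset finite_subset)
  then obtain b where "B - A = {b}" by (auto simp: card_1_singleton_iff)
  then show ?thesis using assms that[of b] by auto
qed

text \<open>\<open>C\<close> is the intersection of \<open>A1\<close> and \<open>A2\<close>, whose
  union is \<open>B1\<close>. The sets \<open>B2\<close> and \<open>B3\<close> each add one element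
  to \<open>A2\<close> and \<open>A1\<close>, and \<open>A3\<close> inside both forces these
  elements to agree.\<close>

lemma hexagon_structure:
  assumes fin: "finite B1" "finite B2" "finite B3"
    and cA: "card A1 = k" "card A2 = k" "card A3 = k"
    and cB: "card B1 = Suc k" "card B2 = Suc k" "card B3 = Suc k"
    and sub: "A1 \<subseteq> B1" "A2 \<subseteq> B1" "A2 \<subseteq> B2" "A3 \<subseteq> B2" "A3 \<subseteq> B3" "A1 \<subseteq> B3"
    and neqA: "A1 \<noteq> A2" "A2 \<noteq> A3" "A1 \<noteq> A3" and neqB: "B1 \<noteq> B2" "B2 \<noteq> B3" "B1 \<noteq> B3"
  obtains C a b c where "a \<notin> C" "b \<notin> C" "c \<notin> C" "a \<noteq> b" "b \<noteq> c" "a \<noteq> c" "finite C" "Suc (card C) = k"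
    "A1 = insert a C" "A2 = insert b C" "A3 = insert c C"
    "B1 = insert a (insert b C)" "B2 = insert b (insert c C)" "B3 = insert c (insert a C)"
proof -
  obtain b where b: "b \<notin> A1" "B1 = insert b A1"
    using card_Suc_superset[of B1 A1] fin sub cA cB by auto
  obtain a where a: "a \<notin> A2" "B1 = insert a A2"
    using card_Suc_superset[of B1 A2] fin sub cA cB by auto
  obtain c where c: "c \<notin> A2" "B2 = insert c A2"
    using card_Suc_superset[of B2 A2] fin sub cA cB by auto
  obtain d where d: "d \<notin> A1" "B3 = insert d A1"
    using card_Suc_superset[of B3 A1] fin sub cA cB by auto
  define C where "C = A1 - {a}"
  have "a \<noteq> b" using a b neqA(1) by (auto simp: insert_ident)
  moreover have "a \<in> insert b A1" "b \<in> insert a A2"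
    using a(2) b(2) by (metis insertI1)+
  ultimately have ab: "a \<noteq> b" "a \<in> A1" "b \<in> A2" by auto
  have A1: "A1 = insert a C" and A2: "A2 = insert b C" and "a \<notin> C" "b \<notin> C"
    using a b ab unfolding C_def by auto
  \<comment> \<open>Otherwise \<open>B2\<close> or \<open>B3\<close> would coincide with
    \<open>B1\<close>.\<close>
  have "c \<noteq> a" "d \<noteq> b" using neqB(1,3) a(2) b(2) c(2) d(2) by metis+
  have finC: "finite C" using fin b A1 by auto
  have cC: "Suc (card C) = k" using cA(1) A1 \<open>a \<notin> C\<close> finC by simp
  \<comment> \<open>\<open>A3\<close> lies in \<open>B2\<close>, which is \<open>C\<close> with
    \<open>b\<close> and \<open>c\<close>, and in \<open>B3\<close>, which is \<open>C\<close> with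
    \<open>a\<close> and \<open>d\<close>; \<open>b\<close> is not in the latter.\<close>
  have "A3 \<subseteq> insert c C"
    using sub c d A1 A2 \<open>c \<noteq> a\<close> \<open>d \<noteq> b\<close> ab \<open>a \<notin> C\<close> \<open>b \<notin> C\<close> by auto
  moreover have "c \<notin> C" using c A2 by auto
  ultimately have A3: "A3 = insert c C"
    using cA(3) cC finC by (intro card_subset_eq) auto
  then have "c = d" using sub d A1 \<open>c \<noteq> a\<close> \<open>c \<notin> C\<close> by auto
  show ?thesis
    by (rule that[of a C b c])
      (use \<open>a \<notin> C\<close> \<open>b \<notin> C\<close> \<open>c \<notin> C\<close> ab c d A1 A2 A3 finC cC \<open>c \<noteq> a\<close> \<open>c = d\<close> b in auto)
qed

text \<open>Index 0 lies outside the ground set \<open>{1..n}\<close>, so \<open>v 0\<close> is free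
  to be the extra vector.\<close>

definition basis_graph :: "nat \<Rightarrow> nat \<Rightarrow> (nat \<Rightarrow> nat) \<Rightarrow> nat set ugraph" where
  "basis_graph r n v =
    (let W = {A \<in> subsets_of_size n (r - 1). xor_indep v (insert 0 A)} \<union>
             {B \<in> subsets_of_size n r. xor_indep v B}
     in \<lparr>verts = W, edges = {e \<in> edges (layer r n). e \<subseteq> W}\<rparr>)"

lemma verts_basis_graph:
  "verts (basis_graph r n v) = {A \<in> subsets_of_size n (r - 1). xor_indep v (insert 0 A)} \<union>
     {B \<in> subsets_of_size n r. xor_indep v B}"
  by (simp add: basis_graph_def Let_def)

lemma edges_basis_graph:
  "edges (basis_graph r n v) = {e \<in> edges (layer r n). e \<subseteq> verts (basis_graph r n v)}"
  by (simp add: basis_graph_def Let_def)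

lemma induced_basis_graph: "induced_subgraph (basis_graph r n v) (layer r n)"
  by (auto simp: induced_subgraph_def edges_basis_graph verts_basis_graph layer_def)

text \<open>Levels alternate along edges, so the level of \<open>X1\<close> fixes all others. The
  six sets then have the shape of \<open>hexagon_structure\<close>, and \<open>no_four_lines\<close>
  applies with \<open>w = 0\<close>.\<close>

lemma basis_graph_no_hexagon:
  assumes r: "1 \<le> r" and v: "\<And>i. i \<in> {0..n} \<Longrightarrow> v i < 2 ^ r"
    and X: "{X1, Y1, X2, Y2, X3, Y3} \<subseteq> verts (basis_graph r n v)"
    and dist: "distinct [X1, Y1, X2, Y2, X3, Y3]"
    and E: "{X1, Y1} \<in> edges (layer r n)" "{Y1, X2} \<in> edges (layer r n)" "{X2, Y2} \<in> edges (layer r n)"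
      "{Y2, X3} \<in> edges (layer r n)" "{X3, Y3} \<in> edges (layer r n)" "{Y3, X1} \<in> edges (layer r n)"
    and card: "card X1 = r - 1"
  shows False
proof -
  note cases = layer_edge_cases[OF _ r]
  have rr: "r - 1 \<noteq> r" using r by simp
  have 1: "card Y1 = r" "X1 \<subseteq> Y1" using cases[OF E(1)] card rr by auto
  have 2: "card X2 = r - 1" "X2 \<subseteq> Y1" using cases[OF E(2)] 1 rr by auto
  have 3: "card Y2 = r" "X2 \<subseteq> Y2" using cases[OF E(3)] 2 rr by auto
  have 4: "card X3 = r - 1" "X3 \<subseteq> Y2" using cases[OF E(4)] 3 rr by auto
  have 5: "card Y3 = r" "X3 \<subseteq> Y3" using cases[OF E(5)] 4 rr by auto
  have 6: "X1 \<subseteq> Y3" using cases[OF E(6)] 5 rr by auto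
  have sub: "Y1 \<subseteq> {1..n}" "Y2 \<subseteq> {1..n}" "Y3 \<subseteq> {1..n}"
    using X by (auto simp: verts_basis_graph subsets_of_size_def)
  then have fin: "finite Y1" "finite Y2" "finite Y3" using finite_subset by blast+
  have iX: "xor_indep v (insert 0 X1)" "xor_indep v (insert 0 X2)" "xor_indep v (insert 0 X3)"
    using X card 2 4 rr by (auto simp: verts_basis_graph subsets_of_size_def)
  have iY: "xor_indep v Y1" "xor_indep v Y2" "xor_indep v Y3"
    using X 1 3 5 rr by (auto simp: verts_basis_graph subsets_of_size_def)
  obtain C a b c where C: "a \<notin> C" "b \<notin> C" "c \<notin> C" "a \<noteq> b" "b \<noteq> c" "a \<noteq> c" "finite C" "Suc (card C) = r - 1"
    "X1 = insert a C" "X2 = insert b C" "X3 = insert c C"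
    "Y1 = insert a (insert b C)" "Y2 = insert b (insert c C)" "Y3 = insert c (insert a C)"
    by (rule hexagon_structure[of Y1 Y2 Y3 X1 "r - 1" X2 X3]) (use fin card 1 2 3 4 5 6 r dist in auto)
  have lt: "v x < 2 ^ r" if "x \<in> insert 0 (insert a (insert b (insert c C)))" for x
    using that v[of x] sub C by auto
  have pos: "0 \<notin> Y1" "0 \<notin> Y2" "0 \<notin> Y3" using sub by auto
  show False
    by (rule no_four_lines[of C r a b c 0 v])
      (use C iX iY lt pos in auto)
qed

lemma basis_graph_no_6_cycle:
  assumes r: "1 \<le> r" and v: "\<And>i. i \<in> {0..n} \<Longrightarrow> v i < 2 ^ r"
  shows "\<not> contains_cycle (basis_graph r n v) 6"
proof
  let ?G = "basis_graph r n v"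
  assume "contains_cycle ?G 6"
  then obtain vs where vs: "length vs = 6" "distinct vs" "set vs \<subseteq> verts ?G"
    and E: "\<And>i. i < 6 \<Longrightarrow> {vs ! i, vs ! ((i + 1) mod 6)} \<in> edges ?G"
    by (auto simp: contains_cycle_def)
  from vs(1) obtain x0 x1 x2 x3 x4 x5 where x: "vs = [x0, x1, x2, x3, x4, x5]"
    by (auto simp: eval_nat_numeral length_Suc_conv)
  have e: "{x0, x1} \<in> edges (layer r n)" "{x1, x2} \<in> edges (layer r n)" "{x2, x3} \<in> edges (layer r n)"
    "{x3, x4} \<in> edges (layer r n)" "{x4, x5} \<in> edges (layer r n)" "{x5, x0} \<in> edges (layer r n)"
    using E[of 0] E[of 1] E[of 2] E[of 3] E[of 4] E[of 5] by (auto simp: x edges_basis_graph)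
  \<comment> \<open>One of two consecutive vertices is in the lower level; if it is
    \<open>x1\<close>, the cycle is rotated by one place.\<close>
  have "card x0 = r - 1 \<or> card x1 = r - 1"
    using layer_edge_cases[OF e(1) r] by auto
  then show False
  proof
    assume "card x0 = r - 1"
    then show False
      using basis_graph_no_hexagon[where v = v, OF r v _ _ e] vs(2,3) unfolding x by simp
  next
    assume "card x1 = r - 1"
    then show False
      using basis_graph_no_hexagon[where v = v, OF r v _ _ e(2-6) e(1)] vs(2,3) unfolding x by simp metis
  qed
qed

section \<open>Averaging\<close>

lemma sum_card_filter_swap:
  assumes "finite A" "finite B"
  shows "(\<Sum>a\<in>A. card {b \<in> B. Q a b}) = (\<Sum>b\<in>B. card {a \<in> A. Q a b})"
proof -
  have "(\<Sum>a\<in>A. card {b \<in> B. Q a b}) = (\<Sum>a\<in>A. \<Sum>b\<in>B. if Q a b then 1 else 0)"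
    using assms by (simp add: sum.If_cases Int_def)
  also have "\<dots> = (\<Sum>b\<in>B. \<Sum>a\<in>A. if Q a b then 1 else 0)" by (rule sum.swap)
  also have "\<dots> = (\<Sum>b\<in>B. card {a \<in> A. Q a b})"
    using assms by (simp add: sum.If_cases Int_def)
  finally show ?thesis .
qed

lemma finite_layer_edges: "finite (edges (layer r n))"
proof (rule finite_subset)
  show "edges (layer r n) \<subseteq> Pow (Pow {1..n})"
    by (auto simp: layer_def subsets_of_size_def)
qed simp

text \<open>Needed for strictness of the final inequality.\<close>

lemma num_edges_layer_pos:
  assumes "1 \<le> r" "r \<le> n"
  shows "num_edges (layer r n) > 0"
proof -
  have "{{1..r - 1}, insert r {1..r - 1}} \<in> edges (layer r n)"
    using assms by (subst layer_edge_iff) (auto intro!: exI[of _ "{1..r - 1}"] exI[of _ r])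
  then show ?thesis
    using finite_layer_edges unfolding num_edges_def by (auto simp: card_gt_0_iff)
qed

lemma card_basis_graph_edge:
  assumes r: "1 \<le> r" and e: "e \<in> edges (layer r n)"
  shows "real (card {v \<in> {0..n} \<rightarrow>\<^sub>E {..<2 ^ r}. e \<in> edges (basis_graph r n v)}) =
    real (card ({0..n} \<rightarrow>\<^sub>E {..<2 ^ r :: nat})) * ((\<Prod>i<r. 1 - 2 ^ i / 2 ^ r) / 2)"
proof -
  let ?F = "{0..n} \<rightarrow>\<^sub>E {..<2 ^ r :: nat}"
  obtain A b where A: "A \<subseteq> {1..n}" "card A = r - 1" "b \<in> {1..n}" "b \<notin> A" "e = {A, insert b A}"
    using e r by (auto simp: layer_edge_iff)
  have finA: "finite A" using A finite_subset by blast
  have cB: "card (insert b A) = r" using A finA r by simp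
  have rr: "r - 1 \<noteq> r" using r by simp
  \<comment> \<open>Since \<open>r - 1 \<noteq> r\<close>, each end of the edge can only satisfy the
    clause for its own level.\<close>
  have kept: "{v \<in> ?F. e \<in> edges (basis_graph r n v)} =
      {v \<in> ?F. xor_indep v (insert b A) \<and> xor_indep v (insert 0 A)}"
    using A e cB rr by (auto simp: edges_basis_graph verts_basis_graph subsets_of_size_def)
  have 1: "real (card {v \<in> ?F. xor_indep v (insert b A) \<and> xor_indep v (insert 0 A)}) =
      real (card {v \<in> ?F. xor_indep v (insert b A)}) * (1 - 2 ^ card A / 2 ^ r)"
  proof (rule card_xor_indep_insert)
    show "xor_indep v A" if "xor_indep v (insert b A)" for v
      using that finA A by (simp add: xor_indep_insert_iff)
    show "0 \<notin> insert b A" "insert b A \<subseteq> {0..n}" using A(1,3) by auto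
    show "card A \<le> r" using A(2) by simp
  qed auto
  have 2: "real (card {v \<in> ?F. xor_indep v (insert b A)}) =
      real (card ?F) * (\<Prod>i<card (insert b A). 1 - 2 ^ i / 2 ^ r)"
  proof (rule card_xor_indep)
    show "insert b A \<subseteq> {0..n}" using A(1,3) by auto
  qed (simp_all only: cB finite_atLeastAtMost order_refl)
  \<comment> \<open>\<open>A\<close> has \<open>r - 1\<close> elements, so its span is a hyperplane,
    half of the space.\<close>
  have 3: "1 - 2 ^ card A / 2 ^ r = (1 / 2 :: real)"
    using A r by (cases r) auto
  show ?thesis unfolding kept 1 2 3 cB by simp
qed

text \<open>Some \<open>v\<close> does at least as well as the average, computed by exchanging the
  sums over \<open>v\<close> and over edges.\<close>

lemma exists_dense_basis_graph:
  assumes r: "1 \<le> r"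
  obtains v where "v \<in> {0..n} \<rightarrow>\<^sub>E {..<2 ^ r :: nat}"
    "real (num_edges (basis_graph r n v)) \<ge> (\<Prod>i<r. 1 - 2 ^ i / 2 ^ r) / 2 * real (num_edges (layer r n))"
proof -
  let ?F = "{0..n} \<rightarrow>\<^sub>E {..<2 ^ r :: nat}" and ?E = "edges (layer r n)"
  define q where "q = (\<Prod>i<r. 1 - 2 ^ i / 2 ^ r) / (2::real)"
  have finF: "finite ?F" by (auto intro: finite_PiE)
  have neF: "?F \<noteq> {}" by (auto simp: PiE_eq_empty_iff lessThan_empty_iff)
  have "(\<Sum>v\<in>?F. num_edges (basis_graph r n v)) = (\<Sum>v\<in>?F. card {e \<in> ?E. e \<in> edges (basis_graph r n v)})"
    unfolding num_edges_def by (intro sum.cong refl arg_cong[where f = card]) (auto simp: edges_basis_graph)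
  also have "\<dots> = (\<Sum>e\<in>?E. card {v \<in> ?F. e \<in> edges (basis_graph r n v)})"
    using finF finite_layer_edges by (rule sum_card_filter_swap)
  finally have "(\<Sum>v\<in>?F. real (num_edges (basis_graph r n v))) =
      (\<Sum>e\<in>?E. real (card {v \<in> ?F. e \<in> edges (basis_graph r n v)}))"
    by (simp flip: of_nat_sum)
  also have "\<dots> = (\<Sum>e\<in>?E. real (card ?F) * q)"
    unfolding q_def by (intro sum.cong refl card_basis_graph_edge[OF r])
  also have "\<dots> = (\<Sum>v\<in>?F. q * real (num_edges (layer r n)))"
    by (simp add: num_edges_def)
  finally have eq: "(\<Sum>v\<in>?F. real (num_edges (basis_graph r n v))) = \<dots>" .
  have "\<exists>v\<in>?F. real (num_edges (basis_graph r n v)) \<ge> q * real (num_edges (layer r n))"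
  proof (rule ccontr)
    assume "\<not> ?thesis"
    then have "(\<Sum>v\<in>?F. real (num_edges (basis_graph r n v))) < (\<Sum>v\<in>?F. q * real (num_edges (layer r n)))"
      using finF neF by (intro sum_strict_mono) auto
    with eq show False by simp
  qed
  then show ?thesis using that unfolding q_def by blast
qed

section \<open>Finite products against the infinite product\<close>

lemma prod_power_quotient:
  "(\<Prod>i<r. 1 - 2 ^ i / 2 ^ r) = (\<Prod>k<r. 1 - 1 / 2 ^ (k + 1) :: real)"
proof -
  \<comment> \<open>The factors are reversed; for \<open>i < r\<close> the exponent
    \<open>r - Suc i + 1\<close> is \<open>r - i\<close>.\<close>
  have "(\<Prod>k<r. 1 - 1 / 2 ^ (k + 1) :: real) = (\<Prod>i<r. 1 - 1 / 2 ^ (r - Suc i + 1))"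
    by (rule prod.nat_diff_reindex[symmetric])
  also have "\<dots> = (\<Prod>i<r. 1 - 2 ^ i / 2 ^ r)"
  proof (rule prod.cong)
    fix i assume "i \<in> {..<r}"
    then have "(2::real) ^ r = 2 ^ (r - Suc i + 1) * 2 ^ i"
      by (simp flip: power_add power_Suc)
    then show "1 - 1 / 2 ^ (r - Suc i + 1) = (1 - 2 ^ i / 2 ^ r :: real)" by simp
  qed simp
  finally show ?thesis by simp
qed

text \<open>Partial products decrease to the limit, which is thus at most the product with the
  further factor \<open>f r\<close>; that factor is below 1 and gives strictness.\<close>

lemma prodinf_less_partial_prod:
  fixes f :: "nat \<Rightarrow> real"
  assumes f: "convergent_prod f" "\<And>k. 0 < f k" "\<And>k. f k < 1"
  shows "prodinf f < (\<Prod>k<r. f k)"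
proof -
  have lim: "(\<lambda>m. \<Prod>k\<le>m. f k) \<longlonglongrightarrow> prodinf f"
    using f(1) by (rule convergent_prod_LIMSEQ)
  have pos: "0 < (\<Prod>k\<le>m. f k)" "0 < (\<Prod>k<m. f k)" for m
    using f(2) by (auto intro: prod_pos)
  have "decseq (\<lambda>m. \<Prod>k\<le>m. f k)"
    using pos f(3) by (intro decseq_SucI) (simp add: mult_left_le less_imp_le)
  then have "prodinf f \<le> (\<Prod>k\<le>r. f k)"
    using lim by (rule decseq_ge)
  also have "\<dots> = (\<Prod>k<r. f k) * f r"
    by (simp flip: lessThan_Suc_atMost)
  also have "\<dots> < (\<Prod>k<r. f k)"
    using pos(2)[of r] f(3)[of r] by simp
  finally show ?thesis .
qed

text \<open>The deviations of the factors from 1 form a geometric series, so the product converges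
  absolutely.\<close>

lemma convergent_prod_one_minus_half_powers:
  "convergent_prod (\<lambda>k. 1 - 1 / 2 ^ (k + 1) :: real)"
proof -
  have "summable (\<lambda>k. (1 / 2 :: real) ^ (k + 1))"
    by (simp add: summable_geometric)
  then have "summable (\<lambda>k. norm ((1 - 1 / 2 ^ (k + 1) :: real) - 1))"
    by (simp add: power_divide)
  then have "abs_convergent_prod (\<lambda>k. 1 - 1 / 2 ^ (k + 1) :: real)"
    by (rule summable_imp_abs_convergent_prod)
  then show ?thesis by (rule abs_convergent_prod_imp_convergent_prod)
qed

theorem theorem1p3:
  fixes r n :: nat and c :: real
  assumes "1 \<le> r" and "r \<le> n"
    and "c = (\<Prod>k. 1 - 1 / 2 ^ (k + 1))"
  shows "\<exists>G. induced_subgraph G (layer r n) \<and> \<not> contains_cycle G 6 \<and>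
           real (num_edges G) > c / 2 * real (num_edges (layer r n))"
proof -
  obtain v where v: "v \<in> {0..n} \<rightarrow>\<^sub>E {..<2 ^ r :: nat}" and
    dense: "real (num_edges (basis_graph r n v)) \<ge>
      (\<Prod>i<r. 1 - 2 ^ i / 2 ^ r) / 2 * real (num_edges (layer r n))"
    using exists_dense_basis_graph[OF assms(1)] by blast
  have "c < (\<Prod>k<r. 1 - 1 / 2 ^ (k + 1))"
    unfolding assms(3)
  proof (rule prodinf_less_partial_prod[OF convergent_prod_one_minus_half_powers])
    show "0 < 1 - 1 / (2::real) ^ (k + 1)" for k
      using one_less_power[of "2::real" "k + 1"] by simp
    show "1 - 1 / (2::real) ^ (k + 1) < 1" for k by simp
  qed
  \<comment> \<open>Strictness survives the multiplication because the layer has an edge.\<close>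
  then have "c / 2 * real (num_edges (layer r n)) <
      (\<Prod>i<r. 1 - 2 ^ i / 2 ^ r) / 2 * real (num_edges (layer r n))"
    using num_edges_layer_pos[OF assms(1,2)]
    unfolding prod_power_quotient by (intro mult_strict_right_mono) auto
  also note dense
  finally have "c / 2 * real (num_edges (layer r n)) < real (num_edges (basis_graph r n v))" .
  moreover have "\<not> contains_cycle (basis_graph r n v) 6"
    using v by (intro basis_graph_no_6_cycle[OF assms(1)]) auto
  ultimately show ?thesis using induced_basis_graph by blast
qed

end
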